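(* Let $\mathbb{A}$ be a finite category with Möbius inversion, with Möbius function $\mu$, and let $X: \mathbb{A} \to \mathbf{Set}$ be a functor satisfying $$X \cong \sum_{a \in \mathbb{A}} r(a)\, \mathbb{A}(a, -)$$ for some natural numbers $r(a)$ ($a \in \mathbb{A}$), where the right-hand side is the coproduct in which the representable $\mathbb{A}(a,-)$ occurs $r(a)$ times. Then $$r(a) = \sum_{b \in \mathbb{A}} |Xb|\, \mu(b, a)$$ for all $a \in \mathbb{A}$.
   Context: For a finite category $\mathbb{A}$, let $R(\mathbb{A})$ be the $\mathbb{Q}$-algebra of functions $\mathrm{ob}\,\mathbb{A} \times \mathrm{ob}\,\mathbb{A} \to \mathbb{Q}$ with pointwise addition and scalar multiplication, multiplication $(\theta\phi)(a,c) = \sum_{b} \theta(a,b)\phi(b,c)$, and unit the Kronecker $\delta$. The zeta function $\zeta \in R(\mathbb{A})$ is $\zeta(a,b) = |\mathbb{A}(a,b)|$. The category $\mathbb{A}$ has Möbius inversion if $\zeta$ is invertible in $R(\mathbb{A})$; its inverse $\mu = \zeta^{-1}$ is the Möbius function of $\mathbb{A}$. *)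

theory Defs
  imports "HOL-Algebra.Module" "HOL-Library.FuncSet" HOL.Rat
begin

record ('o, 'm) category_data =
  obj :: "'o set"
  arr :: "'m set"
  src :: "'m \<Rightarrow> 'o"
  tgt :: "'m \<Rightarrow> 'o"
  idn :: "'o \<Rightarrow> 'm"
  comp :: "'m \<Rightarrow> 'm \<Rightarrow> 'm"  \<comment> \<open>\<open>comp C g f\<close> is \<open>g\<close> after \<open>f\<close>\<close>

definition hom_set :: "('o, 'm) category_data \<Rightarrow> 'o \<Rightarrow> 'o \<Rightarrow> 'm set" where
  "hom_set C a b = {f \<in> arr C. src C f = a \<and> tgt C f = b}"

locale category =
  fixes C :: "('o, 'm) category_data"
  assumes src_in [simp]: "f \<in> arr C \<Longrightarrow> src C f \<in> obj C"
    and tgt_in [simp]: "f \<in> arr C \<Longrightarrow> tgt C f \<in> obj C"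
    and idn_hom: "a \<in> obj C \<Longrightarrow> idn C a \<in> hom_set C a a"
    and comp_hom: "\<lbrakk>f \<in> hom_set C a b; g \<in> hom_set C b c\<rbrakk> \<Longrightarrow> comp C g f \<in> hom_set C a c"
    and comp_idn_right: "f \<in> hom_set C a b \<Longrightarrow> comp C f (idn C a) = f"
    and comp_idn_left: "f \<in> hom_set C a b \<Longrightarrow> comp C (idn C b) f = f"
    and comp_assoc: "\<lbrakk>f \<in> hom_set C a b; g \<in> hom_set C b c; h \<in> hom_set C c d\<rbrakk>
        \<Longrightarrow> comp C h (comp C g f) = comp C (comp C h g) f"

locale finite_category = category +
  assumes finite_obj: "finite (obj C)"
    and finite_arr: "finite (arr C)"

text \<open>Elements of \<open>R(C)\<close> are functions on pairs of objects, extensional (that is, \<open>undefined\<close>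
  off \<open>obj C \<times> obj C\<close>) so that each function on \<open>obj C \<times> obj C\<close> is represented exactly once.\<close>

definition incidence_algebra :: "('o, 'm) category_data \<Rightarrow> (rat, 'o \<times> 'o \<Rightarrow> rat) module" where
  "incidence_algebra C =
    \<lparr>carrier = (obj C \<times> obj C) \<rightarrow>\<^sub>E UNIV,
     mult = (\<lambda>\<theta> \<phi>. \<lambda>(a, c) \<in> obj C \<times> obj C. \<Sum>b\<in>obj C. \<theta> (a, b) * \<phi> (b, c)),
     one = (\<lambda>(a, b) \<in> obj C \<times> obj C. if a = b then 1 else 0),
     zero = (\<lambda>_ \<in> obj C \<times> obj C. 0),
     add = (\<lambda>\<theta> \<phi>. \<lambda>p \<in> obj C \<times> obj C. \<theta> p + \<phi> p),
     smult = (\<lambda>q \<theta>. \<lambda>p \<in> obj C \<times> obj C. q * \<theta> p)\<rparr>"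

definition zeta :: "('o, 'm) category_data \<Rightarrow> 'o \<times> 'o \<Rightarrow> rat" where
  "zeta C = (\<lambda>(a, b) \<in> obj C \<times> obj C. of_nat (card (hom_set C a b)))"

definition has_moebius_inversion :: "('o, 'm) category_data \<Rightarrow> bool" where
  "has_moebius_inversion C \<longleftrightarrow> zeta C \<in> Units (incidence_algebra C)"

definition moebius :: "('o, 'm) category_data \<Rightarrow> 'o \<times> 'o \<Rightarrow> rat" where
  "moebius C = inv\<^bsub>incidence_algebra C\<^esub> (zeta C)"

text \<open>A functor to sets takes its values in subsets of a type \<open>'x\<close>. Functions between such
  subsets are HOL functions, of which only the values on the domain matter.\<close>

record ('o, 'm, 'x) functor_data =
  fobj :: "'o \<Rightarrow> 'x set"
  fmap :: "'m \<Rightarrow> 'x \<Rightarrow> 'x"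

locale set_functor = category C for C :: "('o, 'm) category_data" +
  fixes X :: "('o, 'm, 'x) functor_data"
  assumes fmap_in: "f \<in> hom_set C a b \<Longrightarrow> fmap X f \<in> fobj X a \<rightarrow> fobj X b"
    and fmap_idn: "\<lbrakk>a \<in> obj C; x \<in> fobj X a\<rbrakk> \<Longrightarrow> fmap X (idn C a) x = x"
    and fmap_comp: "\<lbrakk>f \<in> hom_set C a b; g \<in> hom_set C b c; x \<in> fobj X a\<rbrakk>
        \<Longrightarrow> fmap X (comp C g f) x = fmap X g (fmap X f x)"

definition natural_transformation ::
  "('o, 'm) category_data \<Rightarrow> ('o, 'm, 'x) functor_data \<Rightarrow> ('o, 'm, 'y) functor_data
    \<Rightarrow> ('o \<Rightarrow> 'x \<Rightarrow> 'y) \<Rightarrow> bool" where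
  "natural_transformation C X Y \<eta> \<longleftrightarrow>
    (\<forall>a\<in>obj C. \<eta> a \<in> fobj X a \<rightarrow> fobj Y a) \<and>
    (\<forall>a\<in>obj C. \<forall>b\<in>obj C. \<forall>f\<in>hom_set C a b. \<forall>x\<in>fobj X a.
       \<eta> b (fmap X f x) = fmap Y f (\<eta> a x))"

definition functors_isomorphic ::
  "('o, 'm) category_data \<Rightarrow> ('o, 'm, 'x) functor_data \<Rightarrow> ('o, 'm, 'y) functor_data \<Rightarrow> bool" where
  "functors_isomorphic C X Y \<longleftrightarrow>
    (\<exists>\<eta> \<epsilon>. natural_transformation C X Y \<eta> \<and> natural_transformation C Y X \<epsilon> \<and>
       (\<forall>a\<in>obj C. (\<forall>x\<in>fobj X a. \<epsilon> a (\<eta> a x) = x) \<and> (\<forall>y\<in>fobj Y a. \<eta> a (\<epsilon> a y) = y)))"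

definition representable :: "('o, 'm) category_data \<Rightarrow> 'o \<Rightarrow> ('o, 'm, 'm) functor_data" where
  "representable C a = \<lparr>fobj = (\<lambda>b. hom_set C a b), fmap = (\<lambda>g f. comp C g f)\<rparr>"

text \<open>Coproducts of set-valued functors are computed objectwise, as disjoint unions.\<close>

definition coproduct ::
  "'i set \<Rightarrow> ('i \<Rightarrow> ('o, 'm, 'x) functor_data) \<Rightarrow> ('o, 'm, 'i \<times> 'x) functor_data" where
  "coproduct I F =
    \<lparr>fobj = (\<lambda>b. SIGMA i:I. fobj (F i) b), fmap = (\<lambda>g (i, x). (i, fmap (F i) g x))\<rparr>"

text \<open>The index \<open>(a, i)\<close> with \<open>i < r a\<close> labels the \<open>i\<close>-th copy of the functor represented
  by \<open>a\<close>.\<close>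

definition sum_of_representables ::
  "('o, 'm) category_data \<Rightarrow> ('o \<Rightarrow> nat) \<Rightarrow> ('o, 'm, ('o \<times> nat) \<times> 'm) functor_data" where
  "sum_of_representables C r =
    coproduct (SIGMA a:obj C. {..<r a}) (\<lambda>(a, i). representable C a)"

lemma (in category) set_functor_representable: "set_functor C (representable C a)"
  by unfold_locales
    (auto simp: representable_def intro: comp_hom comp_idn_left comp_assoc[symmetric])

lemma (in category) set_functor_coproduct:
  assumes "\<And>i. i \<in> I \<Longrightarrow> set_functor C (F i)"
  shows "set_functor C (coproduct I F)"
proof unfold_locales
  show "fmap (coproduct I F) f \<in> fobj (coproduct I F) a \<rightarrow> fobj (coproduct I F) b"
    if "f \<in> hom_set C a b" for f a b
    using set_functor.fmap_in[OF assms that] by (fastforce simp: coproduct_def)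
  show "fmap (coproduct I F) (idn C a) x = x"
    if "a \<in> obj C" "x \<in> fobj (coproduct I F) a" for a x
    using that set_functor.fmap_idn[OF assms] by (auto simp: coproduct_def)
  show "fmap (coproduct I F) (comp C g f) x
      = fmap (coproduct I F) g (fmap (coproduct I F) f x)"
    if "f \<in> hom_set C a b" "g \<in> hom_set C b c" "x \<in> fobj (coproduct I F) a" for f a b g c x
    using that set_functor.fmap_comp[OF assms] by (auto simp: coproduct_def)
qed

lemma (in finite_category) monoid_incidence_algebra: "monoid (incidence_algebra C)"
proof
  let ?R = "incidence_algebra C"
  show "\<theta> \<otimes>\<^bsub>?R\<^esub> \<phi> \<in> carrier ?R" for \<theta> \<phi>
    by (simp add: incidence_algebra_def)
  show "\<one>\<^bsub>?R\<^esub> \<in> carrier ?R"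
    by (simp add: incidence_algebra_def)
  show "\<theta> \<otimes>\<^bsub>?R\<^esub> \<phi> \<otimes>\<^bsub>?R\<^esub> \<psi> = \<theta> \<otimes>\<^bsub>?R\<^esub> (\<phi> \<otimes>\<^bsub>?R\<^esub> \<psi>)" for \<theta> \<phi> \<psi>
  proof -
    have "(\<Sum>c\<in>obj C. (\<Sum>b\<in>obj C. \<theta> (a, b) * \<phi> (b, c)) * \<psi> (c, d))
        = (\<Sum>b\<in>obj C. \<theta> (a, b) * (\<Sum>c\<in>obj C. \<phi> (b, c) * \<psi> (c, d)))" for a d
      unfolding sum_distrib_left sum_distrib_right
      by (subst sum.swap) (simp add: mult.assoc)
    then show ?thesis
      by (auto simp: incidence_algebra_def restrict_def fun_eq_iff cong: sum.cong)
  qed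
  show "\<one>\<^bsub>?R\<^esub> \<otimes>\<^bsub>?R\<^esub> \<theta> = \<theta>" if "\<theta> \<in> carrier ?R" for \<theta>
    using that finite_obj
    by (auto simp: incidence_algebra_def restrict_def fun_eq_iff PiE_def extensional_def
        if_distrib[of "\<lambda>x. x * _"] sum.delta cong: sum.cong if_cong)
  show "\<theta> \<otimes>\<^bsub>?R\<^esub> \<one>\<^bsub>?R\<^esub> = \<theta>" if "\<theta> \<in> carrier ?R" for \<theta>
    using that finite_obj
    by (auto simp: incidence_algebra_def restrict_def fun_eq_iff PiE_def extensional_def
        if_distrib[of "\<lambda>x. _ * x"] sum.delta' cong: sum.cong if_cong)
qed

end

theory Submission
  imports Defs
begin

text \<open>Isomorphic functors have objectwise equal cardinalities, and the value at \<open>b\<close> of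
  the coproduct of representables is a disjoint union of \<open>r c\<close> copies of the set of arrows
  \<open>c \<rightarrow> b\<close>, for each object \<open>c\<close>. So the cardinality of \<open>X\<close> at \<open>b\<close> is \<open>\<Sum>c. r c * \<zeta> (c, b)\<close>
  (lemma \<open>card_sum_of_representables\<close>): read as row vectors indexed by objects, the
  cardinalities of \<open>X\<close> are \<open>r\<close> times the matrix \<open>\<zeta>\<close>. Multiplying on the right by
  \<open>\<mu> = \<zeta>\<inverse>\<close> (entrywise in lemma \<open>sum_zeta_moebius\<close>) recovers \<open>r\<close>.\<close>

lemma functors_isomorphic_card_eq:
  assumes "functors_isomorphic C X Y" and b: "b \<in> obj C"
  shows "card (fobj X b) = card (fobj Y b)"
proof -
  obtain \<eta> \<epsilon> where "natural_transformation C X Y \<eta>" "natural_transformation C Y X \<epsilon>"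
    and "\<forall>a\<in>obj C. (\<forall>x\<in>fobj X a. \<epsilon> a (\<eta> a x) = x) \<and> (\<forall>y\<in>fobj Y a. \<eta> a (\<epsilon> a y) = y)"
    using assms(1) unfolding functors_isomorphic_def by blast
  then have "bij_betw (\<eta> b) (fobj X b) (fobj Y b)"
    using b by (intro bij_betw_byWitness[where f' = "\<epsilon> b"])
      (auto simp: natural_transformation_def)
  then show ?thesis
    by (rule bij_betw_same_card)
qed

context finite_category
begin

lemma finite_hom_set: "finite (hom_set C a b)"
  using finite_arr by (simp add: hom_set_def)

lemma card_sum_of_representables:
  "card (fobj (sum_of_representables C r) b) = (\<Sum>c\<in>obj C. r c * card (hom_set C c b))"
proof -
  have "fobj (sum_of_representables C r) b
      = (SIGMA p:(SIGMA c:obj C. {..<r c}). hom_set C (fst p) b)"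
    by (auto simp: sum_of_representables_def coproduct_def representable_def split: prod.splits)
  then have "card (fobj (sum_of_representables C r) b)
      = (\<Sum>p\<in>(SIGMA c:obj C. {..<r c}). card (hom_set C (fst p) b))"
    using finite_obj finite_hom_set by (simp add: card_SigmaI)
  also have "\<dots> = (\<Sum>c\<in>obj C. \<Sum>i<r c. card (hom_set C c b))"
    using finite_obj by (subst sum.Sigma) (auto simp: case_prod_unfold)
  finally show ?thesis
    by simp
qed

lemma sum_zeta_moebius:
  assumes "has_moebius_inversion C" and "c \<in> obj C" "a \<in> obj C"
  shows "(\<Sum>b\<in>obj C. of_nat (card (hom_set C c b)) * moebius C (b, a)) = (if c = a then 1 else 0)"
proof -
  interpret R: monoid "incidence_algebra C"
    by (rule monoid_incidence_algebra)
  have "zeta C \<otimes>\<^bsub>incidence_algebra C\<^esub> moebius C = \<one>\<^bsub>incidence_algebra C\<^esub>"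
    using assms(1) by (simp add: has_moebius_inversion_def moebius_def)
  from fun_cong[OF this, of "(c, a)"] show ?thesis
    using assms(2,3) by (simp add: incidence_algebra_def zeta_def)
qed

end

theorem proposition1p8:
  fixes C :: "('o, 'm) category_data"
    and X :: "('o, 'm, 'x) functor_data"
    and r :: "'o \<Rightarrow> nat"
  assumes "finite_category C"
    and "has_moebius_inversion C"
    and "set_functor C X"
    and "functors_isomorphic C X (sum_of_representables C r)"
  shows "\<forall>a\<in>obj C. of_nat (r a) = (\<Sum>b\<in>obj C. of_nat (card (fobj X b)) * moebius C (b, a))"
proof
  interpret finite_category C by fact
  fix a assume a: "a \<in> obj C"
  have "(\<Sum>b\<in>obj C. of_nat (card (fobj X b)) * moebius C (b, a))
      = (\<Sum>b\<in>obj C. (\<Sum>c\<in>obj C. of_nat (r c) * of_nat (card (hom_set C c b))) * moebius C (b, a))"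
    using functors_isomorphic_card_eq[OF assms(4)]
    by (intro sum.cong) (auto simp: card_sum_of_representables)
  also have "\<dots> = (\<Sum>c\<in>obj C. of_nat (r c) *
      (\<Sum>b\<in>obj C. of_nat (card (hom_set C c b)) * moebius C (b, a)))"
    unfolding sum_distrib_left sum_distrib_right by (subst sum.swap) (simp add: mult.assoc)
  also have "\<dots> = (\<Sum>c\<in>obj C. of_nat (r c) * (if c = a then 1 else 0))"
    using sum_zeta_moebius[OF assms(2) _ a] by (intro sum.cong) auto
  also have "\<dots> = of_nat (r a)"
    using a finite_obj by (simp add: if_distrib cong: if_cong)
  finally show "of_nat (r a) = (\<Sum>b\<in>obj C. of_nat (card (fobj X b)) * moebius C (b, a))"
    by simp
qed

end
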